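(* Let $d=2$ and let $v_1,v_2,v_3\in\mathbb{F}_2^2$. Then in $\mathcal{C}(I^2)_{\mathbb{Q}}$ $$\mathrm{ldeg}(F_{v_1}F_{v_2}F_{v_3})=\begin{cases}-32&\text{if }v_1=v_2=v_3=(1,1),\\ 16&\text{if }\{v_1,v_2,v_3\}=\{(1,0),(0,1),(1,1)\},\\ 0&\text{otherwise.}\end{cases}$$
   Context: For $d\ge1$, $\mathcal{C}(I^d)$ (the combinatorial Chow ring of the $d$-th power of the 1-simplex $I=\Delta[1]$) is the quotient of the graded polynomial ring $\mathbb{Z}[C_v\mid v\in\mathbb{F}_2^d]$ (generators of degree 1) by the ideal generated by: (1) $C_vC_w$ for all $v,w\in\mathbb{F}_2^d$ which are incomparable in the product order (where $0<1$ in each coordinate); (2) $\big(\sum_{w\in\mathbb{F}_2^d}C_w\big)C_v$ for all $v$; (3) $C_vC_{v'}\sum_{w\in\mathbb{F}_2^d,\ w_i=v_i}C_w$ for all $i\in\{1,\ldots,d\}$ and $v,v'$ with $v_i\neq v'_i$. Put $\mathcal{C}(I^d)_{\mathbb{Q}}=\mathcal{C}(I^d)\otimes_{\mathbb{Z}}\mathbb{Q}$. The local degree map $\mathrm{ldeg}:\mathcal{C}^{d+1}(I^d)\to\mathbb{Z}$ (on the degree $d+1$ part, extended $\mathbb{Q}$-linearly) is the group homomorphism uniquely determined by $\mathrm{ldeg}(C_{v_0}C_{v_1}\cdots C_{v_d})=1$ for every strictly increasing chain $v_0<v_1<\cdots<v_d$ in the product order. (It is defined as the intersection-theoretic degree of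 products of components of the special fibre of the desingularization, by successively blowing up the strict transforms of the special-fibre components in lexicographic order, of $\bar L^d$, $\bar L=\mathrm{Proj}\,R[x_0,x_1,z]/(x_0x_1-\pi z^2)$, over a complete discrete valuation ring $R$ with uniformizer $\pi$ and algebraically closed residue field.) For $v\in\mathbb{F}_2^d$ put $F_v:=\sum_{w\in\mathbb{F}_2^d}(-1)^{\langle v,w\rangle}C_w$, where $\langle v,w\rangle=\sum_i v_iw_i\in\mathbb{F}_2$. *)

theory Defs
  imports
    "HOL-Analysis.Analysis"
    "HOL-Library.Poly_Mapping"
    "HOL-Library.Z2"
begin

section \<open>Ideals and quotients of commutative rings\<close>

text \<open>A commutative ring as a module over itself: \<open>ideal.span G\<close> is the ideal generated by \<open>G\<close>.\<close>

interpretation ideal: module "(*) :: 'a::comm_ring_1 \<Rightarrow> 'a \<Rightarrow> 'a"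
  by unfold_locales (simp_all add: algebra_simps)

declare ideal.scale_scale [simp del]  \<comment> \<open>the reverse of \<open>mult.assoc\<close>\<close>

definition ideal_cong :: "'a::comm_ring_1 set \<Rightarrow> 'a \<Rightarrow> 'a \<Rightarrow> bool" where
  "ideal_cong G x y \<longleftrightarrow> x - y \<in> ideal.span G"

lemma ideal_cong_refl: "ideal_cong G x x"
  by (simp add: ideal_cong_def ideal.span_zero)

lemma ideal_cong_sym: "ideal_cong G x y \<Longrightarrow> ideal_cong G y x"
  unfolding ideal_cong_def using ideal.span_neg by fastforce

lemma ideal_cong_trans: "ideal_cong G x y \<Longrightarrow> ideal_cong G y z \<Longrightarrow> ideal_cong G x z"
  unfolding ideal_cong_def using ideal.span_add by fastforce

lemma equivp_ideal_cong: "equivp (ideal_cong G)"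
  by (intro equivpI reflpI sympI transpI)
     (blast intro: ideal_cong_refl ideal_cong_sym ideal_cong_trans)+

lemma ideal_cong_add:
  assumes "ideal_cong G x x'" "ideal_cong G y y'"
  shows "ideal_cong G (x + y) (x' + y')"
  using ideal.span_add[OF assms[unfolded ideal_cong_def]]
  by (simp add: ideal_cong_def algebra_simps)

lemma ideal_cong_minus: "ideal_cong G x x' \<Longrightarrow> ideal_cong G (- x) (- x')"
  unfolding ideal_cong_def using ideal.span_neg by fastforce

lemma ideal_cong_diff:
  assumes "ideal_cong G x x'" "ideal_cong G y y'"
  shows "ideal_cong G (x - y) (x' - y')"
  using ideal_cong_add[OF assms(1) ideal_cong_minus[OF assms(2)]] by simp

lemma ideal_cong_mult:
  assumes "ideal_cong G x x'" "ideal_cong G y y'"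
  shows "ideal_cong G (x * y) (x' * y')"
proof -
  have "y * (x - x') + x' * (y - y') \<in> ideal.span G"
    using assms unfolding ideal_cong_def by (intro ideal.span_add ideal.span_scale)
  then show ?thesis by (simp add: ideal_cong_def algebra_simps)
qed


section \<open>The index set \<open>\<F>\<^sub>2\<^sup>d\<close>\<close>

text \<open>
  \<open>\<F>\<^sub>2\<^sup>d\<close> is \<open>bit ^ 'd\<close> with \<open>d = CARD('d)\<close>. With the order \<open>0 < 1\<close> on \<open>bit\<close>, the
  library's componentwise order on vectors is the product order.
\<close>

instantiation bit :: linorder
begin

definition less_eq_bit :: "bit \<Rightarrow> bit \<Rightarrow> bool" where
  "(a::bit) \<le> b \<longleftrightarrow> a = 0 \<or> b = 1"

definition less_bit :: "bit \<Rightarrow> bit \<Rightarrow> bool" where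
  "(a::bit) < b \<longleftrightarrow> a = 0 \<and> b = 1"

instance
  by standard (auto simp: less_eq_bit_def less_bit_def bit_not_zero_iff bit_not_one_iff)

end

instance bit :: finite
proof
  have "(UNIV :: bit set) = {0, 1}"
    using bit_not_zero_iff by auto
  then show "finite (UNIV :: bit set)"
    by (metis finite.emptyI finite_insert)
qed

definition bdot :: "bit ^ 'd \<Rightarrow> bit ^ 'd \<Rightarrow> bit" where
  "bdot v w = (\<Sum>i\<in>UNIV. v $ i * w $ i)"


section \<open>The combinatorial Chow ring \<open>\<C>(I\<^sup>d)\<close>\<close>

text \<open>
  A finitely supported map from exponent vectors (finitely supported maps from the variables to
  \<open>nat\<close>) to coefficients is a polynomial, and the product of \<open>Poly_Mapping\<close> is the
  product of polynomials.
\<close>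

type_synonym 'd chow_poly = "(bit ^ 'd \<Rightarrow>\<^sub>0 nat) \<Rightarrow>\<^sub>0 int"

definition pvar :: "bit ^ 'd \<Rightarrow> 'd chow_poly" where
  "pvar v = Poly_Mapping.single (Poly_Mapping.single v 1) 1"

definition homogeneous :: "nat \<Rightarrow> 'd::finite chow_poly \<Rightarrow> bool" where
  "homogeneous n p \<longleftrightarrow>
     (\<forall>m\<in>Poly_Mapping.keys p. (\<Sum>v\<in>UNIV. Poly_Mapping.lookup m v) = n)"

definition chow_relations :: "'d::finite chow_poly set" where
  "chow_relations =
     {pvar v * pvar w | v w. \<not> v \<le> w \<and> \<not> w \<le> v}
   \<union> {(\<Sum>w\<in>UNIV. pvar w) * pvar v | v. True}
   \<union> {pvar v * pvar v' * (\<Sum>w | w $ i = v $ i. pvar w) | i v v'. v $ i \<noteq> v' $ i}"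

quotient_type 'd chow = "'d::finite chow_poly" / "ideal_cong (chow_relations :: 'd chow_poly set)"
  by (rule equivp_ideal_cong)

lemma lookup_zero_mult:
  fixes p q :: "'d::finite chow_poly"
  shows "Poly_Mapping.lookup (p * q) 0 = Poly_Mapping.lookup p 0 * Poly_Mapping.lookup q 0"
proof -
  have sum0: "0 = l + m \<longleftrightarrow> l = 0 \<and> m = 0" for l m :: "bit ^ 'd \<Rightarrow>\<^sub>0 nat"
    by (auto simp: poly_mapping_eq_iff lookup_add fun_eq_iff)
  have "(\<Sum>m. Poly_Mapping.lookup q m when 0 = l + m) = (Poly_Mapping.lookup q 0 when l = 0)" for l
    by (cases "l = 0") (simp_all add: sum0)
  then show ?thesis
    by (simp add: lookup_mult mult_when)
qed

lemma one_notin_chow_ideal: "1 \<notin> ideal.span (chow_relations :: 'd::finite chow_poly set)"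
proof
  have "ideal.subspace {p :: 'd chow_poly. Poly_Mapping.lookup p 0 = 0}"
    by (auto simp: ideal.subspace_def lookup_zero_mult lookup_add)
  moreover have v0: "Poly_Mapping.lookup (pvar v) 0 = 0" for v :: "bit ^ 'd"
  proof -
    have "Poly_Mapping.single v (1 :: nat) \<noteq> 0"
      by (metis lookup_single_eq lookup_zero zero_neq_one)
    then show ?thesis
      by (simp add: pvar_def lookup_single_not_eq)
  qed
  then have "chow_relations \<subseteq> {p :: 'd chow_poly. Poly_Mapping.lookup p 0 = 0}"
    by (auto simp: chow_relations_def lookup_zero_mult)
  moreover assume "1 \<in> ideal.span (chow_relations :: 'd chow_poly set)"
  ultimately have "Poly_Mapping.lookup (1 :: 'd chow_poly) 0 = 0"
    using ideal.span_minimal by blast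
  then show False by simp
qed

instantiation chow :: (finite) comm_ring_1
begin

lift_definition zero_chow :: "'a chow" is 0 .
lift_definition one_chow :: "'a chow" is 1 .
lift_definition plus_chow :: "'a chow \<Rightarrow> 'a chow \<Rightarrow> 'a chow" is "(+)" by (rule ideal_cong_add)
lift_definition minus_chow :: "'a chow \<Rightarrow> 'a chow \<Rightarrow> 'a chow" is "(-)" by (rule ideal_cong_diff)
lift_definition uminus_chow :: "'a chow \<Rightarrow> 'a chow" is uminus by (rule ideal_cong_minus)
lift_definition times_chow :: "'a chow \<Rightarrow> 'a chow \<Rightarrow> 'a chow" is "(*)" by (rule ideal_cong_mult)

instance
proof
  show "(0 :: 'a chow) \<noteq> 1"
    using one_notin_chow_ideal ideal_cong_sym[of chow_relations "0 :: 'a chow_poly" 1]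
    by (auto simp: zero_chow_def one_chow_def chow.abs_eq_iff ideal_cong_def)
  fix x y z :: "'a chow"
  show "x + y + z = x + (y + z)" by transfer (simp add: add.assoc ideal_cong_refl)
  show "x + y = y + x" by transfer (simp add: add.commute ideal_cong_refl)
  show "0 + x = x" by transfer (simp add: ideal_cong_refl)
  show "- x + x = 0" by transfer (simp add: ideal_cong_refl)
  show "x - y = x + - y" by transfer (simp add: ideal_cong_refl)
  show "x * y * z = x * (y * z)" by transfer (simp add: mult.assoc ideal_cong_refl)
  show "x * y = y * x" by transfer (simp add: mult.commute ideal_cong_refl)
  show "1 * x = x" by transfer (simp add: ideal_cong_refl)
  show "(x + y) * z = x * z + y * z" by transfer (simp add: distrib_right ideal_cong_refl)
qed

end

lift_definition chowC :: "bit ^ 'd \<Rightarrow> 'd::finite chow" is pvar .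

definition chow_deg :: "nat \<Rightarrow> 'd::finite chow set" where
  "chow_deg n = abs_chow ` {p. homogeneous n p}"


section \<open>The local degree map\<close>

text \<open>
  A group homomorphism on the degree \<open>d + 1\<close> part is represented by its extension by
  \<open>undefined\<close>, so that it is determined as a HOL function on the whole ring.
\<close>

definition is_ldeg :: "('d::finite chow \<Rightarrow> int) \<Rightarrow> bool" where
  "is_ldeg f \<longleftrightarrow>
     f \<in> extensional (chow_deg (CARD('d) + 1)) \<and>
     (\<forall>x \<in> chow_deg (CARD('d) + 1). \<forall>y \<in> chow_deg (CARD('d) + 1). f (x + y) = f x + f y) \<and>
     (\<forall>c :: nat \<Rightarrow> bit ^ 'd. (\<forall>i < CARD('d). c i < c (Suc i)) \<longrightarrow>
        f (\<Prod>i \<le> CARD('d). chowC (c i)) = 1)"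

definition ldeg :: "'d::finite chow \<Rightarrow> int" where
  "ldeg = (THE f. is_ldeg f)"


section \<open>Rational coefficients: \<open>\<C>(I\<^sup>d) \<otimes>\<^sub>\<int> \<rat>\<close>\<close>

text \<open>
  \<open>A \<otimes>\<^sub>\<int> B\<close> is the free abelian group on \<open>A \<times> B\<close> modulo the bilinearity relations. Writing the
  multiplicative monoids of \<open>A\<close> and \<open>B\<close> additively, this free abelian group with the product
  \<open>[a, b] [a', b'] = [a a', b b']\<close> is an instance of \<open>Poly_Mapping\<close>. The product of a
  bilinearity relation with a generator \<open>[a, b]\<close> is again a bilinearity relation, so the
  subgroup they generate is the ideal they generate.
\<close>

datatype 'a mult_mon = Mul (unMul: 'a)

instantiation mult_mon :: (comm_monoid_mult) comm_monoid_add
begin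

definition zero_mult_mon :: "'a mult_mon" where
  "zero_mult_mon = Mul 1"

definition plus_mult_mon :: "'a mult_mon \<Rightarrow> 'a mult_mon \<Rightarrow> 'a mult_mon" where
  "plus_mult_mon x y = Mul (unMul x * unMul y)"

instance
  by standard (simp_all add: zero_mult_mon_def plus_mult_mon_def ac_simps)

end

type_synonym ('a, 'b) free_pairs = "('a mult_mon \<times> 'b mult_mon) \<Rightarrow>\<^sub>0 int"

definition free_pair :: "'a \<Rightarrow> 'b \<Rightarrow> ('a, 'b) free_pairs" where
  "free_pair a b = Poly_Mapping.single (Mul a, Mul b) 1"

definition bilinear_relations :: "('a::comm_ring_1, 'b::comm_ring_1) free_pairs set" where
  "bilinear_relations =
     {free_pair (a + a') b - free_pair a b - free_pair a' b | a a' b. True}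
   \<union> {free_pair a (b + b') - free_pair a b - free_pair a b' | a b b'. True}"

lemma free_pair_mult: "free_pair a b * free_pair a' b' = free_pair (a * a') (b * b')"
  by (simp add: free_pair_def mult_single plus_mult_mon_def)

lemma free_pair_one: "free_pair 1 1 = 1"
  by (simp add: free_pair_def flip: zero_mult_mon_def zero_prod_def)

quotient_type 'd chowQ = "('d::finite chow, rat) free_pairs" /
    "ideal_cong (bilinear_relations :: ('d chow, rat) free_pairs set)"
  by (rule equivp_ideal_cong)

instantiation chowQ :: (finite) "{comm_ring, comm_monoid_mult}"
begin

lift_definition zero_chowQ :: "'a chowQ" is 0 .
lift_definition one_chowQ :: "'a chowQ" is 1 .
lift_definition plus_chowQ :: "'a chowQ \<Rightarrow> 'a chowQ \<Rightarrow> 'a chowQ" is "(+)" by (rule ideal_cong_add)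
lift_definition minus_chowQ :: "'a chowQ \<Rightarrow> 'a chowQ \<Rightarrow> 'a chowQ" is "(-)" by (rule ideal_cong_diff)
lift_definition uminus_chowQ :: "'a chowQ \<Rightarrow> 'a chowQ" is uminus by (rule ideal_cong_minus)
lift_definition times_chowQ :: "'a chowQ \<Rightarrow> 'a chowQ \<Rightarrow> 'a chowQ" is "(*)" by (rule ideal_cong_mult)

instance
proof
  fix x y z :: "'a chowQ"
  show "x + y + z = x + (y + z)" by transfer (simp add: add.assoc ideal_cong_refl)
  show "x + y = y + x" by transfer (simp add: add.commute ideal_cong_refl)
  show "0 + x = x" by transfer (simp add: ideal_cong_refl)
  show "- x + x = 0" by transfer (simp add: ideal_cong_refl)
  show "x - y = x + - y" by transfer (simp add: ideal_cong_refl)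
  show "x * y * z = x * (y * z)" by transfer (simp add: mult.assoc ideal_cong_refl)
  show "x * y = y * x" by transfer (simp add: mult.commute ideal_cong_refl)
  show "1 * x = x" by transfer (simp add: ideal_cong_refl)
  show "(x + y) * z = x * z + y * z" by transfer (simp add: distrib_right ideal_cong_refl)
qed

end

definition pure_tensor :: "'d::finite chow \<Rightarrow> rat \<Rightarrow> 'd chowQ" (infixl "\<otimes>\<^sub>\<rat>" 75) where
  "x \<otimes>\<^sub>\<rat> q = abs_chowQ (free_pair x q)"

lemma pure_tensor_add_right: "x \<otimes>\<^sub>\<rat> (q + r) = x \<otimes>\<^sub>\<rat> q + x \<otimes>\<^sub>\<rat> r"
proof -
  have "free_pair x (q + r) - free_pair x q - free_pair x r \<in> bilinear_relations"
    unfolding bilinear_relations_def by blast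
  then have "ideal_cong bilinear_relations (free_pair x (q + r)) (free_pair x q + free_pair x r)"
    by (simp add: ideal_cong_def ideal.span_base diff_diff_eq)
  then show ?thesis
    by (simp add: pure_tensor_def plus_chowQ.abs_eq chowQ.abs_eq_iff)
qed

lemma pure_tensor_mult: "(x \<otimes>\<^sub>\<rat> q) * (y \<otimes>\<^sub>\<rat> r) = (x * y) \<otimes>\<^sub>\<rat> (q * r)"
  by (simp add: pure_tensor_def times_chowQ.abs_eq free_pair_mult)

lemma pure_tensor_one: "1 \<otimes>\<^sub>\<rat> 1 = 1"
  by (simp add: pure_tensor_def one_chowQ_def free_pair_one)

definition scaleQ :: "rat \<Rightarrow> 'd::finite chowQ \<Rightarrow> 'd chowQ" where
  "scaleQ q x = (1 \<otimes>\<^sub>\<rat> q) * x"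

interpretation chowQ: module "scaleQ :: rat \<Rightarrow> 'd::finite chowQ \<Rightarrow> 'd chowQ"
  by unfold_locales
     (simp_all add: scaleQ_def pure_tensor_add_right pure_tensor_one pure_tensor_mult
       distrib_left distrib_right flip: mult.assoc)

definition chowQ_deg :: "nat \<Rightarrow> 'd::finite chowQ set" where
  "chowQ_deg n = chowQ.span ((\<lambda>x. x \<otimes>\<^sub>\<rat> 1) ` chow_deg n)"

definition is_ldegQ :: "('d::finite chowQ \<Rightarrow> rat) \<Rightarrow> bool" where
  "is_ldegQ f \<longleftrightarrow>
     f \<in> extensional (chowQ_deg (CARD('d) + 1)) \<and>
     (\<forall>x \<in> chowQ_deg (CARD('d) + 1). \<forall>y \<in> chowQ_deg (CARD('d) + 1). f (x + y) = f x + f y) \<and>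
     (\<forall>q. \<forall>x \<in> chowQ_deg (CARD('d) + 1). f (scaleQ q x) = q * f x) \<and>
     (\<forall>x \<in> chow_deg (CARD('d) + 1). f (x \<otimes>\<^sub>\<rat> 1) = of_int (ldeg x))"

definition ldegQ :: "'d::finite chowQ \<Rightarrow> rat" where
  "ldegQ = (THE f. is_ldegQ f)"

definition chowF :: "bit ^ 'd \<Rightarrow> 'd::finite chowQ" where
  "chowF v = (\<Sum>w\<in>UNIV. scaleQ ((- 1) ^ of_bit (bdot v w)) (chowC w \<otimes>\<^sub>\<rat> 1))"

end

theory Submission
  imports Defs
begin

text \<open>
  Modulo the relations every cubic monomial is an integer multiple of
  \<open>t = C\<^sub>0\<^sub>0 C\<^sub>1\<^sub>0 C\<^sub>1\<^sub>1\<close>: the face relations reduce the monomials in two variables to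
  \<open>t\<close>, and the linear relations then reduce the cubes. Conversely, the functional on polynomials
  that assigns to every cubic monomial this multiple, and \<open>0\<close> to all other monomials, kills the
  ideal of relations. Hence the degree 3 part is free on \<open>t\<close>, which makes the local degree well
  defined, and the products of the \<open>F\<^sub>v\<close> can be evaluated by expanding them into monomials.
\<close>

section \<open>Linear functionals on monoid rings\<close>

text \<open>The additive map out of the free abelian group on a monoid that takes the values
  \<open>W\<close> on the basis. The target is a general ring because integer values serve for
  polynomials and rational values for the tensor product.\<close>

definition lin_ext :: "('m \<Rightarrow> 'b::comm_ring_1) \<Rightarrow> ('m \<Rightarrow>\<^sub>0 int) \<Rightarrow> 'b" where
  "lin_ext W p = (\<Sum>m\<in>Poly_Mapping.keys p. of_int (Poly_Mapping.lookup p m) * W m)"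

lemma lin_ext_superset:
  assumes "finite A" "Poly_Mapping.keys p \<subseteq> A"
  shows "lin_ext W p = (\<Sum>m\<in>A. of_int (Poly_Mapping.lookup p m) * W m)"
  unfolding lin_ext_def using assms
  by (intro sum.mono_neutral_left) (auto simp: in_keys_iff)

lemma lin_ext_zero [simp]: "lin_ext W 0 = 0"
  by (simp add: lin_ext_def)

lemma lin_ext_single [simp]: "lin_ext W (Poly_Mapping.single m c) = of_int c * W m"
  by (subst lin_ext_superset[of "{m}"]) auto

lemma lin_ext_add: "lin_ext W (p + q) = lin_ext W p + lin_ext W q"
proof -
  let ?A = "Poly_Mapping.keys p \<union> Poly_Mapping.keys q"
  have "Poly_Mapping.keys (p + q) \<subseteq> ?A"
    by (rule keys_add)
  then show ?thesis
    by (simp add: lin_ext_superset[of ?A] lookup_add sum.distrib distrib_right)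
qed

lemma lin_ext_uminus: "lin_ext W (- p) = - lin_ext W p"
  using lin_ext_add[of W p "- p"] by (simp add: eq_neg_iff_add_eq_0 add.commute)

lemma lin_ext_diff: "lin_ext W (p - q) = lin_ext W p - lin_ext W q"
  using lin_ext_add[of W p "- q"] by (simp add: lin_ext_uminus)

lemma sum_single_lookup:
  "(\<Sum>m\<in>Poly_Mapping.keys p. Poly_Mapping.single m (Poly_Mapping.lookup p m)) = p"
  by (rule poly_mapping_eqI) (simp add: lookup_sum lookup_single when_def in_keys_iff)

lemma monom_induct [case_names single add]:
  fixes p :: "'m \<Rightarrow>\<^sub>0 'c::comm_monoid_add"
  assumes "\<And>m c. P (Poly_Mapping.single m c)"
    and "\<And>p q. P p \<Longrightarrow> P q \<Longrightarrow> P (p + q)"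
  shows "P p"
proof -
  have "P (\<Sum>i\<in>I. Poly_Mapping.single i (Poly_Mapping.lookup p i))" if "finite I" for I
    using that
  proof induction
    case empty
    \<comment> \<open>The empty sum counts as a monomial with coefficient 0.\<close>
    then show ?case using assms(1)[of undefined 0] by simp
  qed (simp add: assms)
  from this[OF finite_keys[of p]] show ?thesis
    by (simp add: sum_single_lookup)
qed

text \<open>Both sides are additive in \<open>p\<close> and in \<open>r\<close>, so it suffices to
  compare them on two monomials, where the product adds the exponents.\<close>

lemma lin_ext_mult:
  fixes p r :: "'m::comm_monoid_add \<Rightarrow>\<^sub>0 int"
  shows "lin_ext W (p * r) = lin_ext (\<lambda>m. lin_ext (\<lambda>n. W (m + n)) r) p"
proof (induction p rule: monom_induct)
  case (single m c)
  show ?case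
  proof (induction r rule: monom_induct)
    case (single n d)
    then show ?case by (simp add: mult_single mult.assoc)
  qed (simp add: lin_ext_add distrib_left)
qed (simp add: lin_ext_add distrib_right)

text \<open>An element of the ideal is a sum of multiples of generators, and a multiplier is a
  combination of monomials. By \<open>lin_ext_mult\<close> it is therefore enough to test each
  generator after a shift of the weights by a single monomial.\<close>

lemma lin_ext_ideal_zero:
  fixes R :: "('m::comm_monoid_add \<Rightarrow>\<^sub>0 int) set"
  assumes "\<And>r m. r \<in> R \<Longrightarrow> lin_ext (\<lambda>n. W (m + n)) r = 0" and "x \<in> ideal.span R"
  shows "lin_ext W x = 0"
proof -
  have "lin_ext W (p * x) = 0" for p
    using assms(2)
  proof (induction x arbitrary: p rule: ideal.span_induct_alt)
    case (step c r y)
    have "lin_ext W (p * c * r) = 0"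
      unfolding lin_ext_mult[of W "p * c" r] assms(1)[OF step(1)] by (simp add: lin_ext_def)
    with step show ?case
      by (simp add: distrib_left lin_ext_add mult.assoc)
  qed simp
  from this[of 1] show ?thesis by simp
qed

lemma lin_ext_ideal_cong:
  fixes R :: "('m::comm_monoid_add \<Rightarrow>\<^sub>0 int) set"
  assumes "\<And>r m. r \<in> R \<Longrightarrow> lin_ext (\<lambda>n. W (m + n)) r = 0" and "ideal_cong R x y"
  shows "lin_ext W x = lin_ext W y"
  using lin_ext_ideal_zero[OF assms(1), where x = "x - y"] assms(2)
  by (simp add: ideal_cong_def lin_ext_diff)


section \<open>The square \<open>\<F>\<^sub>2\<^sup>2\<close>\<close>

lemma bit_cases: "b = 0 \<or> b = (1::bit)"
  using bit_not_zero_iff by auto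

lemma vector_bit2_eq_iff [simp]:
  "(vector [p, q] :: 'a::zero ^ 2) = vector [r, s] \<longleftrightarrow> p = r \<and> q = s"
  by (simp add: vec_eq_iff forall_2)

lemma bit2_cases:
  fixes v :: "bit ^ 2"
  obtains "v = vector [0, 0]" | "v = vector [1, 0]" | "v = vector [0, 1]" | "v = vector [1, 1]"
proof -
  have "v = vector [v $ 1, v $ 2]"
    by (simp add: vec_eq_iff forall_2)
  then show ?thesis
    using that bit_cases[of "v $ 1"] bit_cases[of "v $ 2"] by metis
qed

lemma UNIV_bit2: "(UNIV :: (bit ^ 2) set) =
    {vector [0, 0], vector [1, 0], vector [0, 1], vector [1, 1]}"
  using bit2_cases by blast

lemma sum_bit2: "(\<Sum>w\<in>UNIV. f w) = f (vector [0, 0]) + f (vector [1, 0]) + f (vector [0, 1])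
    + f (vector [1, 1] :: bit ^ 2)"
  by (simp add: UNIV_bit2 add.assoc)

lemma sum_bit2_face: "(\<Sum>w | w $ i = b. f w) =
   (if i = 1 then f (vector [b, 0]) + f (vector [b, 1]) else f (vector [0, b]) + f (vector [1, b]))"
  for f :: "bit ^ 2 \<Rightarrow> 'a::comm_monoid_add"
proof (cases "i = 1")
  case True
  have "w $ 1 = b \<longleftrightarrow> w = vector [b, 0] \<or> w = vector [b, 1]" for w :: "bit ^ 2"
    using bit_cases[of "w $ 2"] by (auto simp: vec_eq_iff forall_2)
  then have "{w :: bit ^ 2. w $ 1 = b} = {vector [b, 0], vector [b, 1]}"
    by auto
  with True show ?thesis by simp
next
  case False
  then have i: "i = 2" using exhaust_2[of i] by simp
  have "w $ 2 = b \<longleftrightarrow> w = vector [0, b] \<or> w = vector [1, b]" for w :: "bit ^ 2"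
    using bit_cases[of "w $ 1"] by (auto simp: vec_eq_iff forall_2)
  then have "{w :: bit ^ 2. w $ 2 = b} = {vector [0, b], vector [1, b]}"
    by auto
  with i show ?thesis by simp
qed

lemma vector_bit2_le_iff:
  "(vector [p, q] :: bit ^ 2) \<le> vector [r, s] \<longleftrightarrow> p \<le> r \<and> q \<le> s"
  by (simp add: less_eq_vec_def forall_2)


section \<open>The degree functional for \<open>d = 2\<close>\<close>

text \<open>
  The exponents are listed in the order \<open>C\<^sub>0\<^sub>0, C\<^sub>1\<^sub>0, C\<^sub>0\<^sub>1, C\<^sub>1\<^sub>1\<close>. The values are forced by
  the relations and by the value 1 on the two maximal chains.
\<close>

definition deg3_wt :: "nat \<times> nat \<times> nat \<times> nat \<Rightarrow> int" where
  "deg3_wt e =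
     (if e \<in> {(1,1,0,1), (1,0,1,1), (3,0,0,0), (0,0,0,3)} then 1
      else if e \<in> {(2,0,0,1), (1,0,0,2), (1,2,0,0), (0,2,0,1), (1,0,2,0), (0,0,2,1)} then - 1
      else if e \<in> {(0,3,0,0), (0,0,3,0)} then 2
      else 0)"

definition expo :: "(bit ^ 2 \<Rightarrow>\<^sub>0 nat) \<Rightarrow> nat \<times> nat \<times> nat \<times> nat" where
  "expo m = (Poly_Mapping.lookup m (vector [0, 0]), Poly_Mapping.lookup m (vector [1, 0]),
     Poly_Mapping.lookup m (vector [0, 1]), Poly_Mapping.lookup m (vector [1, 1]))"

text \<open>Each tuple in the table of \<open>deg3_wt\<close> has sum 3. This leaves only finitely
  many exponents to inspect in every relation.\<close>

lemma deg3_wt_eq_0: "i + j + k + l \<noteq> 3 \<Longrightarrow> deg3_wt (i, j, k, l) = 0"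
proof (erule contrapos_np)
  assume "deg3_wt (i, j, k, l) \<noteq> 0"
  then have "(i, j, k, l) \<in> {(1,1,0,1), (1,0,1,1), (3,0,0,0), (0,0,0,3)} \<or>
      (i, j, k, l) \<in> {(2,0,0,1), (1,0,0,2), (1,2,0,0), (0,2,0,1), (1,0,2,0), (0,0,2,1)} \<or>
      (i, j, k, l) \<in> {(0,3,0,0), (0,0,3,0)}"
    unfolding deg3_wt_def by meson
  then show "i + j + k + l = 3"
    by (elim disjE insertE emptyE) simp_all
qed

text \<open>These are the values on the monomial with exponents \<open>(i, j, k, l)\<close> times
  each of the four linear relations. The relations are quadratic, so all terms vanish unless the
  monomial is a single variable.\<close>

lemma deg3_wt_linear_relation:
  "deg3_wt (i + 2, j, k, l) + deg3_wt (i + 1, j + 1, k, l) + deg3_wt (i + 1, j, k + 1, l)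
     + deg3_wt (i + 1, j, k, l + 1) = 0" (is ?a)
  "deg3_wt (i + 1, j + 1, k, l) + deg3_wt (i, j + 2, k, l) + deg3_wt (i, j + 1, k + 1, l)
     + deg3_wt (i, j + 1, k, l + 1) = 0" (is ?b)
  "deg3_wt (i + 1, j, k + 1, l) + deg3_wt (i, j + 1, k + 1, l) + deg3_wt (i, j, k + 2, l)
     + deg3_wt (i, j, k + 1, l + 1) = 0" (is ?c)
  "deg3_wt (i + 1, j, k, l + 1) + deg3_wt (i, j + 1, k, l + 1) + deg3_wt (i, j, k + 1, l + 1)
     + deg3_wt (i, j, k, l + 2) = 0" (is ?d)
proof -
  have "?a \<and> ?b \<and> ?c \<and> ?d"
  proof (cases "i + j + k + l = 1")
    case True
    then consider "i = 1" "j = 0" "k = 0" "l = 0" | "i = 0" "j = 1" "k = 0" "l = 0"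
      | "i = 0" "j = 0" "k = 1" "l = 0" | "i = 0" "j = 0" "k = 0" "l = 1"
      by linarith
    then show ?thesis
      by cases (simp_all add: deg3_wt_def)
  qed (simp add: deg3_wt_eq_0)
  then show ?a ?b ?c ?d by blast+
qed

lemma deg3_wt_chow_relations:
  assumes "r \<in> chow_relations"
  shows "lin_ext (\<lambda>n. deg3_wt (expo (m + n))) r = 0"
proof -
  obtain i j k l where m: "expo m = (i, j, k, l)"
    by (cases "expo m")
  then have lk: "Poly_Mapping.lookup m (vector [0, 0]) = i" "Poly_Mapping.lookup m (vector [1, 0]) = j"
      "Poly_Mapping.lookup m (vector [0, 1]) = k" "Poly_Mapping.lookup m (vector [1, 1]) = l"
    by (simp_all add: expo_def)
  note eval = pvar_def mult_single expo_def lookup_add lookup_single lk lin_ext_add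
    distrib_left distrib_right
  from assms consider
    (incomparable) v w where "r = pvar v * pvar w" "\<not> v \<le> w" "\<not> w \<le> v"
    | (linear) v where "r = (\<Sum>w\<in>UNIV. pvar w) * pvar v"
    | (face) a v v' where "r = pvar v * pvar v' * (\<Sum>w | w $ a = v $ a. pvar w)" "v $ a \<noteq> v' $ a"
    unfolding chow_relations_def Un_iff mem_Collect_eq by (elim disjE exE conjE) simp_all
  then show ?thesis
  proof cases
    case incomparable
    \<comment> \<open>The incomparable vertices are (1,0) and (0,1), and no tuple in the table is
      positive at both.\<close>
    have "deg3_wt (i, Suc j, Suc k, l) = 0"
      by (simp add: deg3_wt_def)
    with incomparable show ?thesis
      by (cases v rule: bit2_cases; cases w rule: bit2_cases)
        (simp_all add: vector_bit2_le_iff less_eq_bit_def eval)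
  next
    case linear
    then show ?thesis
      using deg3_wt_linear_relation[of i j k l]
      by (cases v rule: bit2_cases) (simp_all add: sum_bit2 eval)
  next
    case face
    \<comment> \<open>A face relation is already cubic, so the table matters only for the trivial
      multiplier. Any other multiplier leads out of degree 3.\<close>
    consider "a = 1" "i = 0" "j = 0" "k = 0" "l = 0" | "a = 2" "i = 0" "j = 0" "k = 0" "l = 0"
      | "a = 1" "i + j + k + l \<noteq> 0" | "a = 2" "i + j + k + l \<noteq> 0"
      using exhaust_2[of a] by fastforce
    then show ?thesis
      using face
      by cases (cases v rule: bit2_cases; cases v' rule: bit2_cases;
        simp add: sum_bit2_face eval deg3_wt_eq_0; simp add: deg3_wt_def)+
  qed
qed

text \<open>This functional is additive on the whole ring and becomes the local degree after
  restriction to \<open>chow_deg 3\<close>.\<close>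

lift_definition deg3 :: "2 chow \<Rightarrow> int" is "lin_ext (\<lambda>m. deg3_wt (expo m))"
  by (rule lin_ext_ideal_cong[OF deg3_wt_chow_relations])


section \<open>Additivity of the functional and its values on monomials\<close>

lemma deg3_add: "deg3 (x + y) = deg3 x + deg3 y"
  by transfer (rule lin_ext_add)

text \<open>Additivity is assumed only on a subgroup \<open>S\<close>, since a candidate for the
  local degree is additive only on the degree 3 part.\<close>

lemma additive_on_of_int_mult:
  fixes f :: "'a::ring_1 \<Rightarrow> 'b::ring_1"
  assumes diff: "\<And>x y. x \<in> S \<Longrightarrow> y \<in> S \<Longrightarrow> x - y \<in> S"
    and add: "\<And>x y. x \<in> S \<Longrightarrow> y \<in> S \<Longrightarrow> f (x + y) = f x + f y"
    and x: "x \<in> S"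
  shows "f (of_int n * x) = of_int n * f x"
proof -
  have zero: "0 \<in> S"
    using diff[OF x x] by simp
  have plus: "y + z \<in> S" if "y \<in> S" "z \<in> S" for y z
    using diff[OF that(1) diff[OF zero that(2)]] by simp
  have f0: "f 0 = 0"
    using add[OF zero zero] by simp
  have nat: "of_nat k * x \<in> S \<and> f (of_nat k * x) = of_nat k * f x" for k
    by (induction k) (auto simp: distrib_right zero f0 plus add x)
  obtain k l where n: "n = int k - int l"
    by (rule int_diff_cases)
  \<comment> \<open>With \<open>n = k - l\<close>, additivity applied to this sum reduces an integer
    multiple to two natural multiples.\<close>
  have "f (of_nat k * x) = f (of_int n * x + of_nat l * x)"
    by (simp add: n algebra_simps)
  also have "\<dots> = f (of_int n * x) + f (of_nat l * x)"
    using nat by (intro add) (simp_all add: n left_diff_distrib diff)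
  finally show ?thesis
    using nat by (simp add: n left_diff_distrib)
qed

lemma additive_of_int_mult:
  fixes f :: "'a::ring_1 \<Rightarrow> 'b::ring_1"
  assumes "\<And>x y. f (x + y) = f x + f y"
  shows "f (of_int n * x) = of_int n * f x"
  by (rule additive_on_of_int_mult[where S = UNIV]) (simp_all add: assms)

lemma deg3_sum: "deg3 (\<Sum>i\<in>I. x i) = (\<Sum>i\<in>I. deg3 (x i))"
  using Modules.additive.sum[of deg3 x I] deg3_add by (simp add: Modules.additive_def)

lemma deg3_of_int_mult: "deg3 (of_int n * x) = n * deg3 x"
  using additive_of_int_mult[of deg3 n x] deg3_add by simp

lemma deg3_monom: "deg3 (chowC u * chowC v * chowC w) =
    deg3_wt (expo (Poly_Mapping.single u 1 + Poly_Mapping.single v 1 + Poly_Mapping.single w 1))"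
  by (simp add: chowC.abs_eq times_chow.abs_eq deg3.abs_eq pvar_def mult_single)


section \<open>Relations in the Chow ring\<close>

lemma abs_chow_sum: "abs_chow (\<Sum>i\<in>I. p i) = (\<Sum>i\<in>I. abs_chow (p i))"
  by (induction I rule: infinite_finite_induct)
    (simp_all add: zero_chow.abs_eq flip: plus_chow.abs_eq)

lemma abs_chow_of_int_mult: "abs_chow (of_int n * p) = of_int n * abs_chow p"
  by (rule additive_of_int_mult) (simp add: plus_chow.abs_eq)

lemma abs_chow_relation: "r \<in> chow_relations \<Longrightarrow> abs_chow r = 0"
  by (simp add: zero_chow.abs_eq chow.abs_eq_iff ideal_cong_def ideal.span_base)

lemma chowC_incomparable:
  assumes "\<not> v \<le> w" "\<not> w \<le> v"
  shows "chowC v * chowC w = 0"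
proof -
  have "pvar v * pvar w \<in> chow_relations"
    using assms unfolding chow_relations_def by blast
  from abs_chow_relation[OF this] show ?thesis
    by (simp add: chowC.abs_eq times_chow.abs_eq)
qed

lemma chowC_linear: "(\<Sum>w\<in>UNIV. chowC w) * chowC v = 0"
proof -
  have "(\<Sum>w\<in>UNIV. pvar w) * pvar v \<in> chow_relations"
    unfolding chow_relations_def by blast
  from abs_chow_relation[OF this] show ?thesis
    by (simp add: chowC.abs_eq abs_chow_sum flip: times_chow.abs_eq)
qed

lemma chowC_face:
  assumes "v $ i \<noteq> v' $ i"
  shows "chowC v * chowC v' * (\<Sum>w | w $ i = v $ i. chowC w) = 0"
proof -
  have "pvar v * pvar v' * (\<Sum>w | w $ i = v $ i. pvar w) \<in> chow_relations"
    using assms unfolding chow_relations_def by blast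
  from abs_chow_relation[OF this] show ?thesis
    by (simp add: chowC.abs_eq abs_chow_sum flip: times_chow.abs_eq)
qed

text \<open>The relations determine all 20 cubic monomials up to the factor
  \<open>t = a * b * e\<close>: first those with at least two different variables, then the cubes.
  The coefficients found in this way are the entries of \<open>deg3_wt\<close>.\<close>

lemma chowC_monom:
  fixes u v w :: "bit ^ 2"
  shows "chowC u * chowC v * chowC w = of_int (deg3 (chowC u * chowC v * chowC w)) *
    (chowC (vector [0, 0]) * chowC (vector [1, 0]) * chowC (vector [1, 1]))"
proof -
  define a b c e :: "2 chow" where "a = chowC (vector [0, 0])" and "b = chowC (vector [1, 0])"
    and "c = chowC (vector [0, 1])" and "e = chowC (vector [1, 1])"
  note folds = a_def[symmetric] b_def[symmetric] c_def[symmetric] e_def[symmetric]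
  have bc: "b * c = 0"
    unfolding b_def c_def
    by (rule chowC_incomparable) (simp_all add: vector_bit2_le_iff less_eq_bit_def)
  have lin: "(a + b + c + e) * a = 0" "(a + b + c + e) * b = 0"
      "(a + b + c + e) * c = 0" "(a + b + c + e) * e = 0"
    using chowC_linear[of "vector [0, 0] :: bit ^ 2"] chowC_linear[of "vector [1, 0] :: bit ^ 2"]
      chowC_linear[of "vector [0, 1] :: bit ^ 2"] chowC_linear[of "vector [1, 1] :: bit ^ 2"]
    by (simp_all add: sum_bit2 folds)
  \<comment> \<open>Each of the four faces contributes three relations, one for every pair of a
    vertex on the face and a vertex off it, except the pair \<open>b\<close>, \<open>c\<close>,
    whose product is already 0.\<close>
  have face: "a * b * (a + c) = 0" "a * e * (a + c) = 0" "c * e * (a + c) = 0"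
      "a * b * (b + e) = 0" "a * e * (b + e) = 0" "c * e * (b + e) = 0"
      "a * c * (a + b) = 0" "a * e * (a + b) = 0" "b * e * (a + b) = 0"
      "a * c * (c + e) = 0" "a * e * (c + e) = 0" "b * e * (c + e) = 0"
    using chowC_face[of "vector [0, 0]" 1 "vector [1, 0] :: bit ^ 2"]
      chowC_face[of "vector [0, 0]" 1 "vector [1, 1] :: bit ^ 2"]
      chowC_face[of "vector [0, 1]" 1 "vector [1, 1] :: bit ^ 2"]
      chowC_face[of "vector [1, 0]" 1 "vector [0, 0] :: bit ^ 2"]
      chowC_face[of "vector [1, 1]" 1 "vector [0, 0] :: bit ^ 2"]
      chowC_face[of "vector [1, 1]" 1 "vector [0, 1] :: bit ^ 2"]
      chowC_face[of "vector [0, 0]" 2 "vector [0, 1] :: bit ^ 2"]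
      chowC_face[of "vector [0, 0]" 2 "vector [1, 1] :: bit ^ 2"]
      chowC_face[of "vector [1, 0]" 2 "vector [1, 1] :: bit ^ 2"]
      chowC_face[of "vector [0, 1]" 2 "vector [0, 0] :: bit ^ 2"]
      chowC_face[of "vector [1, 1]" 2 "vector [0, 0] :: bit ^ 2"]
      chowC_face[of "vector [1, 1]" 2 "vector [1, 0] :: bit ^ 2"]
    by (simp_all add: sum_bit2_face folds mult.commute)
  define t where "t = a * b * e"
  have abe: "a * b * e = t"
    by (simp add: t_def)
  have bc0: "b * c * a = 0" "b * c * b = 0" "b * c * c = 0" "b * c * e = 0"
    by (simp_all add: bc)
  have aae: "a * a * e = - t"
  proof -
    have "a * a * e = a * e * (a + b) - a * b * e"
      by (simp add: algebra_simps)
    then show ?thesis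
      by (simp add: face(8) abe)
  qed
  \<comment> \<open>The pair \<open>a\<close>, \<open>e\<close> differs in both coordinates, so two
    faces through \<open>a\<close> apply to it. Comparing them shows that the two maximal chains
    have the same class.\<close>
  have ace: "a * c * e = t"
  proof -
    have "a * c * e = a * e * (a + c) - a * a * e"
      by (simp add: algebra_simps)
    then show ?thesis
      by (simp add: face(2) aae)
  qed
  have aab: "a * a * b = 0"
  proof -
    have "a * a * b = a * b * (a + c) - b * c * a"
      by (simp add: algebra_simps)
    then show ?thesis
      by (simp add: face(1) bc)
  qed
  have aac: "a * a * c = 0"
  proof -
    have "a * a * c = a * c * (a + b) - b * c * a"
      by (simp add: algebra_simps)
    then show ?thesis
      by (simp add: face(7) bc)
  qed
  have abb: "a * b * b = - t"
  proof -
    have "a * b * b = a * b * (b + e) - a * b * e"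
      by (simp add: algebra_simps)
    then show ?thesis
      by (simp add: face(4) abe)
  qed
  have acc: "a * c * c = - t"
  proof -
    have "a * c * c = a * c * (c + e) - a * c * e"
      by (simp add: algebra_simps)
    then show ?thesis
      by (simp add: face(10) ace)
  qed
  have aee: "a * e * e = - t"
  proof -
    have "a * e * e = a * e * (b + e) - a * b * e"
      by (simp add: algebra_simps)
    then show ?thesis
      by (simp add: face(5) abe)
  qed
  have bbe: "b * b * e = - t"
  proof -
    have "b * b * e = b * e * (a + b) - a * b * e"
      by (simp add: algebra_simps)
    then show ?thesis
      by (simp add: face(9) abe)
  qed
  have bee: "b * e * e = 0"
  proof -
    have "b * e * e = b * e * (c + e) - b * c * e"
      by (simp add: algebra_simps)
    then show ?thesis
      by (simp add: face(12) bc)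
  qed
  have cce: "c * c * e = - t"
  proof -
    have "c * c * e = c * e * (a + c) - a * c * e"
      by (simp add: algebra_simps)
    then show ?thesis
      by (simp add: face(3) ace)
  qed
  have cee: "c * e * e = 0"
  proof -
    have "c * e * e = c * e * (b + e) - b * c * e"
      by (simp add: algebra_simps)
    then show ?thesis
      by (simp add: face(6) bc)
  qed
  \<comment> \<open>From here on, a linear relation times a variable isolates the cube, since the
    mixed monomials are known.\<close>
  have aaa: "a * a * a = t"
  proof -
    have "a * a * a = (a + b + c + e) * a * a - a * a * b - a * a * c - a * a * e"
      by (simp add: algebra_simps)
    then show ?thesis
      by (simp add: lin(1) aab aac aae)
  qed
  have bbb: "b * b * b = 2 * t"
  proof -
    have "b * b * b = (a + b + c + e) * b * b - a * b * b - b * c * b - b * b * e"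
      by (simp add: algebra_simps)
    then show ?thesis
      by (simp add: lin(2) abb bc bbe)
  qed
  have ccc: "c * c * c = 2 * t"
  proof -
    have "c * c * c = (a + b + c + e) * c * c - a * c * c - b * c * c - c * c * e"
      by (simp add: algebra_simps)
    then show ?thesis
      by (simp add: lin(3) acc bc cce)
  qed
  have eee: "e * e * e = t"
  proof -
    have "e * e * e = (a + b + c + e) * e * e - a * e * e - b * e * e - c * e * e"
      by (simp add: algebra_simps)
    then show ?thesis
      by (simp add: lin(4) aee bee cee)
  qed
  have abc: "a * b * c = 0" "b * b * c = 0"
    using bc0(1,2) by (simp_all add: ac_simps)
  note monoms = abe abc bc0(3,4) aae ace aab aac abb acc aee bbe bee cce cee aaa bbb ccc eee
  show ?thesis
    \<comment> \<open>The 64 ordered triples reduce by commutativity to the 20 monomials in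
      \<open>monoms\<close>.\<close>
    unfolding deg3_monom
    by (cases u rule: bit2_cases; cases v rule: bit2_cases; cases w rule: bit2_cases;
      simp add: folds expo_def lookup_add lookup_single deg3_wt_def monoms[unfolded mult.assoc] ac_simps)
qed


section \<open>Existence and uniqueness of the local degree\<close>

text \<open>A positive total degree forces a positive exponent, so one variable can be split off.
  Three such steps factor a cubic monomial.\<close>

lemma lookup_sum_pos:
  fixes m :: "'v::finite \<Rightarrow>\<^sub>0 nat"
  assumes "(\<Sum>v\<in>UNIV. Poly_Mapping.lookup m v) = Suc n"
  obtains u m' where "m = Poly_Mapping.single u 1 + m'"
    "(\<Sum>v\<in>UNIV. Poly_Mapping.lookup m' v) = n"
proof -
  obtain u where u: "Poly_Mapping.lookup m u > 0"
    using assms by (metis (no_types, lifting) gr0I nat.distinct(1) sum.neutral)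
  \<comment> \<open>Subtraction of exponents is truncated, but the exponent at \<open>u\<close> is
    positive, so adding the variable back recovers \<open>m\<close>.\<close>
  define m' where "m' = m - Poly_Mapping.single u 1"
  have m: "m = Poly_Mapping.single u 1 + m'"
    using u by (intro poly_mapping_eqI)
      (auto simp: m'_def lookup_add lookup_minus lookup_single when_def)
  have "(\<Sum>v\<in>UNIV. Poly_Mapping.lookup m v) = 1 + (\<Sum>v\<in>UNIV. Poly_Mapping.lookup m' v)"
    by (subst m) (simp add: lookup_add sum.distrib lookup_single when_def)
  with assms m that show ?thesis by simp
qed

lemma lookup_sum_eq_3:
  fixes m :: "'v::finite \<Rightarrow>\<^sub>0 nat"
  assumes "(\<Sum>v\<in>UNIV. Poly_Mapping.lookup m v) = 3"
  obtains u v w where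
    "m = Poly_Mapping.single u 1 + Poly_Mapping.single v 1 + Poly_Mapping.single w 1"
proof -
  obtain u m1 where 1: "m = Poly_Mapping.single u 1 + m1" "(\<Sum>v\<in>UNIV. Poly_Mapping.lookup m1 v) = 2"
    using lookup_sum_pos[of m 2] assms by auto
  obtain v m2 where 2: "m1 = Poly_Mapping.single v 1 + m2" "(\<Sum>v\<in>UNIV. Poly_Mapping.lookup m2 v) = 1"
    using lookup_sum_pos[of m1 1] 1(2) by auto
  obtain w m3 where 3: "m2 = Poly_Mapping.single w 1 + m3" "(\<Sum>v\<in>UNIV. Poly_Mapping.lookup m3 v) = 0"
    using lookup_sum_pos[of m2 0] 2(2) by auto
  from 3(2) have "m3 = 0"
    by (intro poly_mapping_eqI) simp
  with 1 2 3 that show ?thesis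
    by (simp add: add.assoc)
qed

section \<open>The homogeneous parts as additive subgroups\<close>

lemma homogeneous_diff:
  assumes "homogeneous n p" "homogeneous n q"
  shows "homogeneous n (p - q)"
proof -
  have "Poly_Mapping.keys (p - q) \<subseteq> Poly_Mapping.keys p \<union> Poly_Mapping.keys q"
    by (rule keys_diff)
  with assms show ?thesis
    unfolding homogeneous_def by blast
qed

lemma chow_deg_diff:
  assumes "x \<in> chow_deg n" "y \<in> chow_deg n"
  shows "x - y \<in> chow_deg n"
proof -
  from assms obtain p q where "x = abs_chow p" "homogeneous n p" "y = abs_chow q" "homogeneous n q"
    unfolding chow_deg_def by blast
  then show ?thesis
    unfolding chow_deg_def by (auto simp: minus_chow.abs_eq intro!: imageI homogeneous_diff)
qed

lemma zero_in_chow_deg: "0 \<in> chow_deg n"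
  unfolding chow_deg_def zero_chow.abs_eq by (intro imageI) (simp add: homogeneous_def)

lemma chow_deg_add:
  assumes "x \<in> chow_deg n" "y \<in> chow_deg n"
  shows "x + y \<in> chow_deg n"
  using chow_deg_diff[OF assms(1) chow_deg_diff[OF zero_in_chow_deg assms(2)]] by simp

lemma chow_deg_sum: "(\<And>i. i \<in> I \<Longrightarrow> x i \<in> chow_deg n) \<Longrightarrow> (\<Sum>i\<in>I. x i) \<in> chow_deg n"
  by (induction I rule: infinite_finite_induct) (simp_all add: zero_in_chow_deg chow_deg_add)

lemma of_int_monom_in_chow_deg: "of_int k * (chowC u * chowC v * chowC w) \<in> chow_deg 3"
proof -
  have "homogeneous 3 (of_int k * (pvar u * pvar v * pvar w))"
    unfolding homogeneous_def pvar_def mult_single single_of_int[symmetric]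
    by (auto simp: lookup_add sum.distrib lookup_single when_def split: if_splits)
  moreover have "of_int k * (chowC u * chowC v * chowC w)
      = abs_chow (of_int k * (pvar u * pvar v * pvar w))"
    unfolding abs_chow_of_int_mult by (simp add: chowC.abs_eq times_chow.abs_eq)
  ultimately show ?thesis
    unfolding chow_deg_def by blast
qed

lemma monom_in_chow_deg: "chowC u * chowC v * chowC w \<in> chow_deg 3"
  using of_int_monom_in_chow_deg[of 1 u v w] by simp

text \<open>A homogeneous representative is a sum of cubic monomials, each a multiple of
  \<open>t\<close> by \<open>chowC_monom\<close>. Additivity of \<open>deg3\<close> collects the
  coefficients.\<close>

lemma chow_deg_3_eq:
  fixes x :: "2 chow"
  assumes "x \<in> chow_deg 3"
  shows "x = of_int (deg3 x) *
    (chowC (vector [0, 0]) * chowC (vector [1, 0]) * chowC (vector [1, 1]))" (is "x = _ * ?t")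
proof -
  obtain p where p: "x = abs_chow p" "homogeneous 3 p"
    using assms unfolding chow_deg_def by blast
  have "x = (\<Sum>m\<in>Poly_Mapping.keys p. abs_chow (Poly_Mapping.single m (Poly_Mapping.lookup p m)))"
    using p(1) sum_single_lookup[of p] abs_chow_sum by metis
  moreover have "abs_chow (Poly_Mapping.single m c) = of_int (deg3 (abs_chow (Poly_Mapping.single m c))) * ?t"
    if m: "m \<in> Poly_Mapping.keys p" for m c
  proof -
    obtain u v w where "m = Poly_Mapping.single u 1 + Poly_Mapping.single v 1 + Poly_Mapping.single w 1"
      using p(2) m lookup_sum_eq_3[of m] unfolding homogeneous_def by blast
    then have "Poly_Mapping.single m c = of_int c * (pvar u * pvar v * pvar w)"
      unfolding pvar_def mult_single single_of_int[symmetric] by simp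
    then have eq: "abs_chow (Poly_Mapping.single m c) = of_int c * (chowC u * chowC v * chowC w)"
      by (simp add: abs_chow_of_int_mult chowC.abs_eq times_chow.abs_eq)
    show ?thesis
      unfolding eq deg3_of_int_mult
      by (subst chowC_monom) (simp add: mult.assoc)
  qed
  ultimately show ?thesis
    by (simp add: deg3_sum sum_distrib_right cong: sum.cong)
qed

section \<open>Maximal chains and the normalization of the local degree\<close>

lemma chain_bit2:
  fixes u v w :: "bit ^ 2"
  assumes "u < v" "v < w"
  shows "u = vector [0, 0]" "v = vector [1, 0] \<or> v = vector [0, 1]" "w = vector [1, 1]"
proof -
  have "u = vector [0, 0] \<and> (v = vector [1, 0] \<or> v = vector [0, 1]) \<and> w = vector [1, 1]"
    using assms unfolding less_le_not_le
    by (cases u rule: bit2_cases; cases v rule: bit2_cases; cases w rule: bit2_cases)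
      (simp_all add: vector_bit2_le_iff less_eq_bit_def)
  then show "u = vector [0, 0]" "v = vector [1, 0] \<or> v = vector [0, 1]" "w = vector [1, 1]"
    by simp_all
qed

lemma is_ldeg_deg3: "is_ldeg (restrict deg3 (chow_deg 3))"
proof -
  have "restrict deg3 (chow_deg 3) (\<Prod>i\<le>2. chowC (c i)) = 1"
    if "\<forall>i<2. c i < c (Suc i)" for c :: "nat \<Rightarrow> bit ^ 2"
  proof -
    have c: "c 0 < c 1" "c 1 < c 2"
      using that[rule_format, of 0] that[rule_format, of 1] by (simp_all add: numeral_2_eq_2)
    have "(\<Prod>i\<le>2. chowC (c i)) = chowC (c 0) * chowC (c 1) * chowC (c 2)"
      by (simp add: numeral_2_eq_2)
    \<comment> \<open>The exponents of the two possible chains are (1,1,0,1) and (1,0,1,1), both of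
      weight 1.\<close>
    moreover have "deg3 (chowC (c 0) * chowC (c 1) * chowC (c 2)) = 1"
      using chain_bit2[OF c]
      by (auto simp: deg3_monom expo_def lookup_add lookup_single deg3_wt_def)
    ultimately show ?thesis
      by (simp add: monom_in_chow_deg)
  qed
  then show ?thesis
    by (auto simp: is_ldeg_def deg3_add chow_deg_add)
qed

text \<open>The chain (0,0) < (1,0) < (1,1) normalizes \<open>f\<close> on the generator of the
  degree 3 part, and additivity does the rest. Outside that part both functions are
  \<open>undefined\<close>.\<close>

lemma is_ldeg_unique:
  fixes f :: "2 chow \<Rightarrow> int"
  assumes "is_ldeg f"
  shows "f = restrict deg3 (chow_deg 3)"
proof
  fix x
  let ?c = "\<lambda>i :: nat. if i = 0 then vector [0, 0] else if i = 1 then vector [1, 0]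
    else vector [1, 1] :: bit ^ 2"
  let ?t = "chowC (vector [0, 0]) * chowC (vector [1, 0]) * chowC (vector [1, 1]) :: 2 chow"
  have f: "f \<in> extensional (chow_deg 3)"
      "\<And>x y. x \<in> chow_deg 3 \<Longrightarrow> y \<in> chow_deg 3 \<Longrightarrow> f (x + y) = f x + f y"
      "\<And>c. (\<forall>i<2. c i < c (Suc i)) \<Longrightarrow> f (\<Prod>i\<le>2. chowC (c i)) = 1"
    using assms by (simp_all add: is_ldeg_def)
  have "vector [0, 0] < (vector [1, 0] :: bit ^ 2)" "vector [1, 0] < (vector [1, 1] :: bit ^ 2)"
    unfolding less_le_not_le by (simp_all add: vector_bit2_le_iff less_eq_bit_def)
  then have "\<forall>i<2. ?c i < ?c (Suc i)"
    by (simp add: less_2_cases_iff)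
  from f(3)[OF this] have t: "f ?t = 1"
    by (simp add: numeral_2_eq_2)
  have of_int_t: "f (of_int n * ?t) = n" for n
    using additive_on_of_int_mult[where S = "chow_deg 3" and f = f and x = ?t and n = n,
        OF chow_deg_diff f(2) monom_in_chow_deg] t by simp
  show "f x = restrict deg3 (chow_deg 3) x"
  proof (cases "x \<in> chow_deg 3")
    case True
    have "f x = f (of_int (deg3 x) * ?t)"
      by (rule arg_cong[OF chow_deg_3_eq[OF True]])
    also have "\<dots> = deg3 x"
      by (rule of_int_t)
    finally show ?thesis
      using True by simp
  next
    case False
    then show ?thesis
      using extensional_arb[OF f(1) False] by simp
  qed
qed

lemma ldeg_eq_deg3: "ldeg = restrict deg3 (chow_deg 3)"
  unfolding ldeg_def using is_ldeg_deg3 is_ldeg_unique by (rule the_equality)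


section \<open>Extension to rational coefficients\<close>

lemma pure_tensor_add_left: "(x + y) \<otimes>\<^sub>\<rat> q = x \<otimes>\<^sub>\<rat> q + y \<otimes>\<^sub>\<rat> q"
proof -
  have "free_pair (x + y) q - free_pair x q - free_pair y q \<in> bilinear_relations"
    unfolding bilinear_relations_def by blast
  then have "ideal_cong bilinear_relations (free_pair (x + y) q) (free_pair x q + free_pair y q)"
    by (simp add: ideal_cong_def ideal.span_base diff_diff_eq)
  then show ?thesis
    by (simp add: pure_tensor_def plus_chowQ.abs_eq chowQ.abs_eq_iff)
qed

lemma pure_tensor_uminus_left: "(- x) \<otimes>\<^sub>\<rat> q = - (x \<otimes>\<^sub>\<rat> q)"
  using Modules.additive.minus[of "\<lambda>x. x \<otimes>\<^sub>\<rat> q" x]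
  by (simp add: Modules.additive_def pure_tensor_add_left)

lemma pure_tensor_uminus_right: "x \<otimes>\<^sub>\<rat> (- q) = - (x \<otimes>\<^sub>\<rat> q)"
  using Modules.additive.minus[of "\<lambda>q. x \<otimes>\<^sub>\<rat> q" q]
  by (simp add: Modules.additive_def pure_tensor_add_right)

lemma pure_tensor_sum_left: "(\<Sum>i\<in>I. x i) \<otimes>\<^sub>\<rat> q = (\<Sum>i\<in>I. x i \<otimes>\<^sub>\<rat> q)"
  using Modules.additive.sum[of "\<lambda>x. x \<otimes>\<^sub>\<rat> q" x I]
  by (simp add: Modules.additive_def pure_tensor_add_left)

lemma chowQ_cases: obtains P where "X = abs_chowQ P"
  using Quotient3_abs_rep[OF Quotient3_chowQ, of X] by metis

section \<open>Extending an additive functional to the rational tensor product\<close>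

context
  fixes L :: "'d::finite chow \<Rightarrow> int"
  assumes L_add: "\<And>x y. L (x + y) = L x + L y"
begin

definition tensor_wt :: "'d chow mult_mon \<times> rat mult_mon \<Rightarrow> rat" where
  "tensor_wt = (\<lambda>(x, q). of_int (L (unMul x)) * unMul q)"

text \<open>The value is read off a chosen representative; \<open>tensor_ext_abs\<close> shows that
  the choice does not matter.\<close>

definition tensor_ext :: "'d chowQ \<Rightarrow> rat" where
  "tensor_ext X = lin_ext tensor_wt (rep_chowQ X)"

lemma tensor_ext_abs: "tensor_ext (abs_chowQ P) = lin_ext tensor_wt P"
proof -
  have "ideal_cong bilinear_relations (rep_chowQ (abs_chowQ P)) P"
    using Quotient3_abs_rep[OF Quotient3_chowQ] by (simp flip: chowQ.abs_eq_iff)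
  \<comment> \<open>A shift by \<open>m\<close> multiplies both entries of a pair by fixed elements,
    which keeps the weight additive in each entry.\<close>
  moreover have "lin_ext (\<lambda>n. tensor_wt (m + n)) r = 0" if "r \<in> bilinear_relations" for r m
    using that unfolding bilinear_relations_def
    by (cases m) (auto simp: lin_ext_diff free_pair_def tensor_wt_def plus_mult_mon_def
        distrib_left L_add distrib_right)
  ultimately show ?thesis
    unfolding tensor_ext_def by (intro lin_ext_ideal_cong)
qed

lemma tensor_ext_add: "tensor_ext (X + Y) = tensor_ext X + tensor_ext Y"
  by (cases X rule: chowQ_cases; cases Y rule: chowQ_cases)
    (simp add: tensor_ext_abs plus_chowQ.abs_eq lin_ext_add)

lemma tensor_ext_scaleQ: "tensor_ext (scaleQ q X) = q * tensor_ext X"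
proof (cases X rule: chowQ_cases)
  case (1 P)
  have "tensor_wt ((Mul 1, Mul q) + n) = q * tensor_wt n" for n
    by (cases n) (simp add: tensor_wt_def plus_mult_mon_def)
  \<comment> \<open>Scaling by \<open>q\<close> is multiplication by the basis element
    \<open>(Mul 1, Mul q)\<close>, so it only shifts the weights.\<close>
  then show ?thesis
    by (simp add: 1 scaleQ_def pure_tensor_def times_chowQ.abs_eq tensor_ext_abs lin_ext_mult
        free_pair_def) (simp add: lin_ext_def sum_distrib_left mult.left_commute)
qed

lemma tensor_ext_pure: "tensor_ext (x \<otimes>\<^sub>\<rat> 1) = of_int (L x)"
  by (simp add: pure_tensor_def tensor_ext_abs free_pair_def tensor_wt_def)

text \<open>The rational degree part is spanned by the integral elements tensored with 1, where the
  values are prescribed by \<open>ldeg\<close>. Linearity then fixes the values on the whole span,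
  and \<open>tensor_ext\<close> realizes them.\<close>

lemma ldegQ_eq_tensor_ext:
  assumes "\<And>x. x \<in> chow_deg (CARD('d) + 1) \<Longrightarrow> L x = ldeg x"
  shows "ldegQ = restrict tensor_ext (chowQ_deg (CARD('d) + 1))"
proof -
  define n where "n = CARD('d) + 1"
  let ?D = "chowQ_deg n :: 'd chowQ set"
  have L: "L x = ldeg x" if "x \<in> chow_deg n" for x
    using assms that unfolding n_def .
  have closed: "X + Y \<in> ?D" "scaleQ q X \<in> ?D" if "X \<in> ?D" "Y \<in> ?D" for X Y q
    using that unfolding chowQ_deg_def by (simp_all add: chowQ.span_add chowQ.span_scale)
  have base: "x \<otimes>\<^sub>\<rat> 1 \<in> ?D" if "x \<in> chow_deg n" for x
    using that unfolding chowQ_deg_def by (intro chowQ.span_base imageI)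
  have "is_ldegQ (restrict tensor_ext ?D)"
    unfolding is_ldegQ_def n_def[symmetric]
    by (auto simp: closed base tensor_ext_add tensor_ext_scaleQ tensor_ext_pure L)
  moreover have "g = restrict tensor_ext ?D" if "is_ldegQ g" for g
  proof
    have g: "g \<in> extensional ?D"
        "\<And>X Y. X \<in> ?D \<Longrightarrow> Y \<in> ?D \<Longrightarrow> g (X + Y) = g X + g Y"
        "\<And>q X. X \<in> ?D \<Longrightarrow> g (scaleQ q X) = q * g X"
        "\<And>x. x \<in> chow_deg n \<Longrightarrow> g (x \<otimes>\<^sub>\<rat> 1) = of_int (ldeg x)"
      using that unfolding is_ldegQ_def n_def[symmetric] by blast+
    fix X
    show "g X = restrict tensor_ext ?D X"
    proof (cases "X \<in> ?D")
      case True
      \<comment> \<open>Membership is carried through the induction because \<open>g\<close> is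
        known to be linear only on \<open>?D\<close>.\<close>
      then have "X \<in> ?D \<and> g X = tensor_ext X"
        unfolding chowQ_deg_def
      proof (induction rule: chowQ.span_induct)
        case base
        have "0 \<in> ?D"
          unfolding chowQ_deg_def by (rule chowQ.span_zero)
        moreover from this have "g 0 = 0" "tensor_ext 0 = 0"
          using g(2)[of 0 0] tensor_ext_add[of 0 0] by simp_all
        ultimately show ?case
          unfolding chowQ.subspace_def chowQ_deg_def[symmetric]
          by (auto simp: tensor_ext_add tensor_ext_scaleQ g closed)
      next
        case (step X)
        then show ?case
          unfolding chowQ_deg_def[symmetric]
          by (auto simp: tensor_ext_pure g base L)
      qed
      with True show ?thesis by simp
    next
      case False
      then show ?thesis
        using extensional_arb[OF g(1) False] by simp
    qed
  qed
  ultimately show ?thesis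
    unfolding ldegQ_def n_def by (rule the_equality[where P = is_ldegQ])
qed

end

lemma ldegQ_pure_tensor:
  fixes x :: "2 chow"
  assumes "x \<in> chow_deg 3"
  shows "ldegQ (x \<otimes>\<^sub>\<rat> 1) = of_int (deg3 x)"
proof -
  have "x \<otimes>\<^sub>\<rat> 1 \<in> chowQ_deg 3"
    using assms unfolding chowQ_deg_def by (intro chowQ.span_base imageI)
  then have "restrict (tensor_ext deg3) (chowQ_deg 3) (x \<otimes>\<^sub>\<rat> 1) = of_int (deg3 x)"
    by (simp add: tensor_ext_pure[OF deg3_add])
  moreover have "(ldegQ :: 2 chowQ \<Rightarrow> rat) = restrict (tensor_ext deg3) (chowQ_deg 3)"
    using ldegQ_eq_tensor_ext[of deg3, OF deg3_add] by (simp add: ldeg_eq_deg3)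
  ultimately show ?thesis
    by metis
qed


section \<open>Products of the elements \<open>F\<^sub>v\<close>\<close>

text \<open>The scalars are signs, hence integers, and can be moved into the Chow ring factor.
  Products of the \<open>chowF v\<close> thus become integral elements tensored with 1.\<close>

lemma chowF_eq:
  fixes v :: "bit ^ 'd::finite"
  shows "chowF v = (\<Sum>w\<in>UNIV. of_int ((- 1) ^ of_bit (bdot v w)) * chowC w) \<otimes>\<^sub>\<rat> 1"
proof -
  have "scaleQ ((- 1) ^ of_bit b) (x \<otimes>\<^sub>\<rat> 1) = (of_int ((- 1) ^ of_bit b) * x) \<otimes>\<^sub>\<rat> 1"
    for b and x :: "'d chow"
    using bit_cases[of b]
    by (auto simp: scaleQ_def pure_tensor_mult pure_tensor_uminus_left pure_tensor_uminus_right)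
  then show ?thesis
    by (simp only: chowF_def pure_tensor_sum_left)
qed

lemma prod_linear_forms:
  fixes x y z :: "bit ^ 'd::finite \<Rightarrow> int"
  shows "(\<Sum>u\<in>UNIV. of_int (x u) * chowC u) * (\<Sum>v\<in>UNIV. of_int (y v) * chowC v)
      * (\<Sum>w\<in>UNIV. of_int (z w) * chowC w)
    = (\<Sum>u\<in>UNIV. \<Sum>v\<in>UNIV. \<Sum>w\<in>UNIV. of_int (x u * y v * z w) * (chowC u * chowC v * chowC w))"
  unfolding mult.assoc sum_distrib_right unfolding sum_distrib_left
  by (intro sum.cong refl) (simp add: ac_simps)

lemma ldegQ_prod_linear_forms:
  fixes x y z :: "bit ^ 2 \<Rightarrow> int"
  shows "ldegQ (((\<Sum>u\<in>UNIV. of_int (x u) * chowC u) \<otimes>\<^sub>\<rat> 1) * ((\<Sum>v\<in>UNIV. of_int (y v) * chowC v) \<otimes>\<^sub>\<rat> 1)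
      * ((\<Sum>w\<in>UNIV. of_int (z w) * chowC w) \<otimes>\<^sub>\<rat> 1))
    = of_int (\<Sum>u\<in>UNIV. \<Sum>v\<in>UNIV. \<Sum>w\<in>UNIV. x u * y v * z w *
        deg3_wt (expo (Poly_Mapping.single u 1 + Poly_Mapping.single v 1 + Poly_Mapping.single w 1)))"
proof -
  have "(\<Sum>u\<in>UNIV. \<Sum>v\<in>UNIV. \<Sum>w\<in>UNIV. of_int (x u * y v * z w) * (chowC u * chowC v * chowC w))
      \<in> chow_deg 3"
    by (intro chow_deg_sum of_int_monom_in_chow_deg)
  from ldegQ_pure_tensor[OF this] show ?thesis
    unfolding pure_tensor_mult prod_linear_forms
    by (simp only: deg3_sum deg3_of_int_mult deg3_monom mult_1_right)
qed

lemma sign_bdot_bit2: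
  "(- 1 :: int) ^ of_bit (bdot (vector [p, q]) (vector [r, s] :: bit ^ 2)) =
    (if p * r + q * s = 0 then 1 else - 1)"
  using bit_cases[of "p * r + q * s"] by (auto simp: bdot_def sum_2)

theorem theorem4p32:
  fixes v1 v2 v3 :: "bit ^ 2"
  shows "ldegQ (chowF v1 * chowF v2 * chowF v3) =
    (if v1 = vector [1, 1] \<and> v2 = vector [1, 1] \<and> v3 = vector [1, 1] then - 32
     else if {v1, v2, v3} = {vector [1, 0], vector [0, 1], vector [1, 1]} then 16
     else 0)" (is "_ = ?rhs")
proof -
  \<comment> \<open>The signs stay folded while the 64 weights are evaluated, so only the terms of
    nonzero weight reach the case split over \<open>v1\<close>, \<open>v2\<close>,
    \<open>v3\<close>.\<close>
  define s :: "bit ^ 2 \<Rightarrow> bit ^ 2 \<Rightarrow> int" where "s v w = (- 1) ^ of_bit (bdot v w)" for v w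
  note sign = sign_bdot_bit2[folded s_def]
  have F: "chowF v = (\<Sum>w\<in>UNIV. of_int (s v w) * chowC w) \<otimes>\<^sub>\<rat> 1" for v
    unfolding chowF_eq s_def ..
  have "of_int (\<Sum>u\<in>UNIV. \<Sum>v\<in>UNIV. \<Sum>w\<in>UNIV. s v1 u * s v2 v * s v3 w *
      deg3_wt (expo (Poly_Mapping.single u 1 + Poly_Mapping.single v 1 + Poly_Mapping.single w 1)))
    = ?rhs"
    unfolding sum_bit2
    by (simp add: expo_def lookup_add lookup_single deg3_wt_def)
      (cases v1 rule: bit2_cases; cases v2 rule: bit2_cases; cases v3 rule: bit2_cases;
        simp add: sign insert_commute set_eq_subset)
  then show ?thesis
    unfolding F ldegQ_prod_linear_forms .
qed
end
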